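(* Consider the Euler--Lagrange system $$\frac{d}{dt}\left[\nabla_{\dot q}\mathcal{L}(q,\dot q)\right]-\nabla_q\mathcal{L}(q,\dot q)=G(q,\dot q)\,\tau,\qquad \mathcal{L}(q,\dot q)=\tfrac12\dot q^\top M(q)\dot q-U(q),$$ with generalized coordinates $q\in\mathbb{R}^{n_q}$ and control $\tau\in\mathbb{R}^m$, $m\le n_q$, where $M(q)>0$ and $$M(q)=\sum_{i=1}^{\ell}\mathbf{m}_i(q)\,\theta_i^M,\qquad U(q)=\sum_{j=1}^{r}U_j(q)\,\theta_j^U .$$ Put $w=\ell+r$ and $\theta=(\theta_1^M,\dots,\theta_\ell^M,\theta_1^U,\dots,\theta_r^U)^\top\in\mathbb{R}^w$. Define the vector $\Omega\in\mathbb{R}^w$ via $$\dot z=-\lambda(z+\omega),\qquad \Omega=z+\omega,$$ with $\lambda>0$ a design parameter and $$\omega:=\left(\tfrac12\dot q^\top\mathbf{m}_1(q)\dot q,\ \dots,\ \tfrac12\dot q^\top\mathbf{m}_\ell(q)\dot q,\ U_1(q),\ \dots,\ U_r(q)\right)^\top\in\mathbb{R}^w .$$ Then the Euler--Lagrange system satisfies the linear regression equation $$y=\Omega^\top\theta,$$ where $y$ is generated by $$\dot y=-\lambda y+\dot q^\top G\,\tau .$$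
   Context: Here $M:\mathbb{R}^{n_q}\to\mathbb{R}^{n_q\times n_q}$ is the generalized inertia matrix, $U:\mathbb{R}^{n_q}\to\mathbb{R}$ is the potential energy function, and $G:\mathbb{R}^{n_q}\times\mathbb{R}^{n_q}\to\mathbb{R}^{n_q\times m}$ is the known input matrix. The matrices $\mathbf{m}_i:\mathbb{R}^{n_q}\to\mathbb{R}^{n_q\times n_q}$ and functions $U_j:\mathbb{R}^{n_q}\to\mathbb{R}$ are known, and the constants $\theta_i^M,\theta_j^U\in\mathbb{R}$ are the unknown parameters. The symbols $\nabla_q\mathcal{L}$ and $\nabla_{\dot q}\mathcal{L}$ denote the transposed gradients of $\mathcal{L}$ with respect to $q$ and $\dot q$. No friction term is present. With $p=\frac{d}{dt}$ and the linear time-invariant filter $H(p)=\frac{1}{p+\lambda}$, the equations for $(z,\Omega)$ and $y$ are state realizations of $\Omega=pH(p)[\omega]$ and $y=H(p)[\dot q^\top G\tau]$, respectively.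
   Formalization: As the initial states of the y and z filters are free, y = Ω^⊤θ is proved up to the term e^{-λt}(y(0) − Ω(0)^⊤θ), with exact equality when y(0) = Ω(0)^⊤θ; M and U are assumed differentiable, and time ranges over an interval containing 0. *)

theory Defs
  imports "HOL-Analysis.Analysis"
begin

text \<open>As usual, \<open>A > 0\<close> for a real matrix includes symmetry.\<close>

definition positive_definite :: "real ^ 'n ^ 'n \<Rightarrow> bool" where
  "positive_definite A \<longleftrightarrow> transpose A = A \<and> (\<forall>x. x \<noteq> 0 \<longrightarrow> x \<bullet> (A *v x) > 0)"

text \<open>The gradient as a column vector; it is only meaningful where the function is
  differentiable.\<close>

definition gradient :: "('a::real_inner \<Rightarrow> real) \<Rightarrow> 'a \<Rightarrow> 'a" where
  "gradient f x = (THE D. GDERIV f x :> D)"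

definition lagrangian ::
  "(real ^ 'n \<Rightarrow> real ^ 'n ^ 'n) \<Rightarrow> (real ^ 'n \<Rightarrow> real) \<Rightarrow> real ^ 'n \<Rightarrow> real ^ 'n \<Rightarrow> real" where
  "lagrangian M U q v = 1 / 2 * (v \<bullet> (M q *v v)) - U q"

text \<open>The curve \<open>q\<close> with velocity \<open>v\<close> is a trajectory, over the time set \<open>T\<close>, of
  the Euler--Lagrange system with Lagrangian \<open>L\<close>, input matrix \<open>G\<close> and
  control signal \<open>\<tau>\<close>. Here \<open>p'\<close> is the time derivative of the generalized momentum
  (one-sided at an endpoint of \<open>T\<close>); differentiability of \<open>v\<close> is not presupposed.\<close>

definition euler_lagrange_trajectory ::
  "(real ^ 'n \<Rightarrow> real ^ 'n \<Rightarrow> real) \<Rightarrow> (real ^ 'n \<Rightarrow> real ^ 'n \<Rightarrow> real ^ 'm ^ 'n) \<Rightarrow>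
   real set \<Rightarrow> (real \<Rightarrow> real ^ 'm) \<Rightarrow> (real \<Rightarrow> real ^ 'n) \<Rightarrow> (real \<Rightarrow> real ^ 'n) \<Rightarrow> bool" where
  "euler_lagrange_trajectory L G T \<tau> q v \<longleftrightarrow>
     (\<forall>t\<in>T. (q has_vector_derivative v t) (at t within T) \<and>
       (\<exists>p'. ((\<lambda>s. gradient (\<lambda>u. L (q s) u) (v s)) has_vector_derivative p') (at t within T) \<and>
             p' - gradient (\<lambda>x. L x (v t)) (q t) = G (q t) (v t) *v \<tau> t))"

text \<open>Vectors in \<open>\<real>\<^sup>w\<close> with \<open>w = \<ell> + r\<close> are indexed by the sum of the two
  index types, so \<open>Inl i\<close> is the entry of \<open>\<theta>\<^sub>i\<^sup>M\<close> and \<open>Inr j\<close> that of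
  \<open>\<theta>\<^sub>j\<^sup>U\<close>.\<close>

definition stacked_parameters :: "real ^ 'l \<Rightarrow> real ^ 'r \<Rightarrow> real ^ ('l + 'r)" where
  "stacked_parameters \<theta>M \<theta>U = (\<chi> k. case k of Inl i \<Rightarrow> \<theta>M $ i | Inr j \<Rightarrow> \<theta>U $ j)"

definition energy_terms ::
  "('l::finite \<Rightarrow> real ^ 'n \<Rightarrow> real ^ 'n ^ 'n) \<Rightarrow> ('r::finite \<Rightarrow> real ^ 'n \<Rightarrow> real) \<Rightarrow>
   real ^ 'n \<Rightarrow> real ^ 'n \<Rightarrow> real ^ ('l + 'r)" where
  "energy_terms m_mat U_fun q v =
     (\<chi> k. case k of Inl i \<Rightarrow> 1 / 2 * (v \<bullet> (m_mat i q *v v)) | Inr j \<Rightarrow> U_fun j q)"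

text \<open>The state equation realizing \<open>y = H(p)[u]\<close> with \<open>H(p) = 1 / (p + lam)\<close>; the initial state
  is left free.\<close>

definition lti_filter :: "real \<Rightarrow> real set \<Rightarrow> (real \<Rightarrow> real) \<Rightarrow> (real \<Rightarrow> real) \<Rightarrow> bool" where
  "lti_filter lam T u y \<longleftrightarrow>
     (\<forall>t\<in>T. (y has_real_derivative (- lam * y t + u t)) (at t within T))"

end

theory Submission imports Defs
begin

text \<open>
  The regression equation is the filtered power balance: the energy
  \<open>E = \<omega> \<bullet> \<theta>\<close> satisfies \<open>E' = v \<bullet> G \<tau>\<close> along trajectories.  Since the momentum
  \<open>p = M v\<close>, but not \<open>v\<close>, is known to be differentiable, the balance is obtained from
  increments: symmetry of \<open>M\<close> gives
  \<open>p s \<bullet> v s - p t \<bullet> v t = (p s - p t) \<bullet> (v s + v t) - v s \<bullet> (M (q s) - M (q t)) v t\<close>,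
  so that only the continuity of \<open>v\<close> is needed, which follows from Cramer's rule.
\<close>

text \<open>Cramer's rule writes \<open>x s\<close> as a quotient of polynomials in the entries of
  \<open>A s\<close> and \<open>A s *v x s\<close>, and such quotients converge where the limiting
  denominator \<open>det A0\<close> is nonzero. This is what turns continuity of the momentum into
  continuity of the velocity.\<close>

lemma matrix_vector_mult_continuous_inverse:
  fixes A :: "'a \<Rightarrow> real ^ 'n ^ 'n" and x :: "'a \<Rightarrow> real ^ 'n"
  assumes A: "(A \<longlongrightarrow> A0) F" and "det A0 \<noteq> 0"
    and Ax: "((\<lambda>s. A s *v x s) \<longlongrightarrow> A0 *v x0) F"
  shows "(x \<longlongrightarrow> x0) F"
proof -
  have det_lim: "((\<lambda>s. det (B s)) \<longlongrightarrow> det B0) F"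
    if "\<And>i j. ((\<lambda>s. B s $ i $ j) \<longlongrightarrow> B0 $ i $ j) F" for B :: "'a \<Rightarrow> real ^ 'n ^ 'n" and B0
    unfolding det_def by (intro tendsto_intros that)
  have lim_det: "((\<lambda>s. det (A s)) \<longlongrightarrow> det A0) F"
    by (intro det_lim tendsto_vec_nth A)
  \<comment> \<open>Cramer's formula for the solution of \<open>B *v x = b\<close>. Division by zero
    makes it total, so it agrees with \<open>x s\<close> only where \<open>det (A s)\<close> is
    nonzero, which holds eventually along \<open>F\<close>.\<close>
  define c where "c B b = (\<chi> k. det (\<chi> i j. if j = k then b $ i else B $ i $ j) / det B)"
    for B :: "real ^ 'n ^ 'n" and b
  have "((\<lambda>s. c (A s) (A s *v x s) $ k) \<longlongrightarrow> c A0 (A0 *v x0) $ k) F" for k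
    unfolding c_def vec_lambda_beta
  proof (intro tendsto_divide[OF det_lim lim_det assms(2)])
    fix i j
    show "((\<lambda>s. (\<chi> i j. if j = k then (A s *v x s) $ i else A s $ i $ j) $ i $ j)
        \<longlongrightarrow> (\<chi> i j. if j = k then (A0 *v x0) $ i else A0 $ i $ j) $ i $ j) F"
      by (cases "j = k") (simp_all add: tendsto_vec_nth[OF Ax] tendsto_vec_nth[OF tendsto_vec_nth[OF A]])
  qed
  then have c_lim: "((\<lambda>s. c (A s) (A s *v x s)) \<longlongrightarrow> c A0 (A0 *v x0)) F"
    by (rule vec_tendstoI)
  have c_A0: "c A0 (A0 *v x0) = x0"
    unfolding c_def by (rule cramer[OF assms(2), THEN iffD1, OF refl, symmetric])
  have "\<forall>\<^sub>F s in F. c (A s) (A s *v x s) = x s"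
    using tendsto_imp_eventually_ne[OF lim_det assms(2)]
    unfolding c_def by eventually_elim (rule cramer[THEN iffD1, OF _ refl, symmetric])
  from Lim_transform_eventually[OF c_lim this] show ?thesis
    unfolding c_A0 .
qed

text \<open>The product vanishes at \<open>s = t\<close>, so its difference quotient is that of
  \<open>f\<close> paired with \<open>h s\<close>; a limit of \<open>h\<close> therefore suffices
  where the product rule would ask for a derivative.\<close>

lemma has_real_derivative_inner_increment:
  fixes f h :: "real \<Rightarrow> 'a::real_inner"
  assumes f: "(f has_vector_derivative f') (at t within T)"
    and h: "(h \<longlongrightarrow> h0) (at t within T)"
  shows "((\<lambda>s. (f s - f t) \<bullet> h s) has_real_derivative f' \<bullet> h0) (at t within T)"
proof -
  have "((\<lambda>s. (f s - f t) /\<^sub>R (s - t)) \<longlongrightarrow> f') (at t within T)"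
  proof (rule Lim_null[THEN iffD2], rule tendsto_norm_zero_cancel)
    have "((\<lambda>s. norm (f s - f t - (s - t) *\<^sub>R f') / norm (s - t)) \<longlongrightarrow> 0) (at t within T)"
      using f by (simp add: has_vector_derivative_def has_derivative_iff_norm)
    moreover have "\<forall>\<^sub>F s in at t within T.
        norm (f s - f t - (s - t) *\<^sub>R f') / norm (s - t) = norm ((f s - f t) /\<^sub>R (s - t) - f')"
    proof (rule eventually_mono)
      show "\<forall>\<^sub>F s in at t within T. s \<noteq> t"
        by (simp add: eventually_at_filter)
      fix s assume "s \<noteq> t"
      then have "(f s - f t) /\<^sub>R (s - t) - f' = (f s - f t - (s - t) *\<^sub>R f') /\<^sub>R (s - t)"
        by (simp add: scaleR_diff_right)
      then show "norm (f s - f t - (s - t) *\<^sub>R f') / norm (s - t) = norm ((f s - f t) /\<^sub>R (s - t) - f')"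
        by (simp add: divide_inverse_commute)
    qed
    ultimately show "((\<lambda>s. norm ((f s - f t) /\<^sub>R (s - t) - f')) \<longlongrightarrow> 0) (at t within T)"
      by (rule Lim_transform_eventually)
  qed
  from tendsto_inner[OF this h] show ?thesis
    unfolding has_field_derivative_iff by (simp add: divide_inverse_commute)
qed

lemma gderiv_unique:
  assumes "GDERIV f x :> D" "GDERIV f x :> D'"
  shows "D = D'"
proof -
  have "(\<lambda>h. h \<bullet> D) = (\<lambda>h. h \<bullet> D')"
    using assms has_derivative_unique unfolding gderiv_def by blast
  then show ?thesis by (metis vector_eq_ldot)
qed

lemma gradient_eqI:
  assumes "GDERIV f x :> D"
  shows "gradient f x = D"
  unfolding gradient_def using assms by (blast intro: gderiv_unique)

text \<open>Riesz representation: the derivative is a linear functional, represented by its adjoint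
  at 1. This gives the definite description in \<open>gradient\<close> its meaning.\<close>

lemma differentiable_imp_gderiv:
  fixes f :: "'a::euclidean_space \<Rightarrow> real"
  assumes "f differentiable (at x)"
  shows "GDERIV f x :> gradient f x"
proof -
  obtain f' where f': "(f has_derivative f') (at x)"
    using assms by (auto simp: differentiable_def)
  then interpret bounded_linear f' by (rule has_derivative_bounded_linear)
  have "f' = (\<lambda>h. h \<bullet> adjoint f' 1)"
    using adjoint_works[OF linear_axioms, of _ 1] by (simp add: fun_eq_iff)
  then have "GDERIV f x :> adjoint f' 1"
    using f' by (simp add: gderiv_def)
  then show ?thesis
    using gradient_eqI by metis
qed

lemma positive_definite_imp_det_nz:
  assumes "positive_definite A"
  shows "det A \<noteq> 0"
proof -
  have "x = 0" if "A *v x = 0" for x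
    using assms that unfolding positive_definite_def by (metis inner_zero_right less_irrefl)
  then show ?thesis
    by (metis invertible_det_nz invertible_left_inverse matrix_left_invertible_ker)
qed

lemma inner_symmetric_matrix:
  fixes A :: "real ^ 'n ^ 'n"
  assumes "transpose A = A"
  shows "x \<bullet> (A *v y) = (A *v x) \<bullet> y"
  using assms by (metis dot_lmul_matrix transpose_matrix_vector)

text \<open>Symmetry merges the two halves of the derivative of the quadratic form. This identifies
  the generalized momentum as \<open>M q *v v\<close>.\<close>

lemma gradient_lagrangian_velocity:
  assumes "transpose (M x) = M x"
  shows "gradient (lagrangian M U x) u = M x *v u"
proof (rule gradient_eqI)
  have "((\<lambda>u. 1 / 2 * (u \<bullet> (M x *v u)) - U x) has_derivative
      (\<lambda>h. 1 / 2 * (u \<bullet> (M x *v h) + h \<bullet> (M x *v u)))) (at u)"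
    by (auto intro!: derivative_eq_intros bounded_linear.has_derivative[OF matrix_vector_mul_bounded_linear])
  then show "GDERIV (lagrangian M U x) u :> M x *v u"
    unfolding gderiv_def lagrangian_def
    using inner_symmetric_matrix[OF assms, of u] by (simp add: inner_commute)
qed

lemma linear_matrix_vector_mult_left: "linear (\<lambda>A :: real ^ 'n ^ 'm. A *v x)"
  by (intro linearI) (simp_all add: matrix_vector_mult_add_rdistrib scaleR_matrix_vector_assoc)

lemma bounded_linear_matrix_vector_mult_left:
  "bounded_linear (\<lambda>A :: real ^ 'n ^ 'm. A *v x)"
  using linear_matrix_vector_mult_left by (rule linear_conv_bounded_linear[THEN iffD1])

lemma energy_balance:
  fixes M :: "real ^ 'n \<Rightarrow> real ^ 'n ^ 'n"
  assumes pd: "\<And>x. positive_definite (M x)"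
    and M: "\<And>x. M differentiable (at x)"
    and U: "\<And>x. U differentiable (at x)"
    and EL: "euler_lagrange_trajectory (lagrangian M U) G T \<tau> q v"
    and t: "t \<in> T"
  shows "((\<lambda>s. 1 / 2 * (v s \<bullet> (M (q s) *v v s)) + U (q s)) has_real_derivative
      v t \<bullet> (G (q t) (v t) *v \<tau> t)) (at t within T)"
proof -
  have sym: "transpose (M x) = M x" for x
    using pd by (auto simp: positive_definite_def)
  define p where "p s = M (q s) *v v s" for s
  \<comment> \<open>Freezing the velocity at \<open>v t\<close> makes the gradient of
    \<open>f\<close> at \<open>q t\<close> exactly the position gradient in the Euler-Lagrange
    equation at time \<open>t\<close>.\<close>
  define f where "f x = lagrangian M U x (v t)" for x
  define g where "g = gradient f (q t)"
  obtain p' where q': "(q has_vector_derivative v t) (at t within T)"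
    and p': "(p has_vector_derivative p') (at t within T)"
    and eq: "p' - g = G (q t) (v t) *v \<tau> t"
    using EL t unfolding euler_lagrange_trajectory_def gradient_lagrangian_velocity[OF sym] p_def f_def g_def
    by auto
  have M_app: "(\<lambda>x. M x *v u) differentiable (at x)" for u x
    using differentiable_compose[of "\<lambda>A. A *v u", OF _ M]
    by (simp add: bounded_linear_imp_differentiable[OF bounded_linear_matrix_vector_mult_left])
  \<comment> \<open>Only existence of these derivatives matters: \<open>A'\<close> yields continuity
    of \<open>M (q s)\<close>, and \<open>a'\<close> gets paired with a limit that is zero.\<close>
  have chain: "\<exists>d. ((\<lambda>s. F (q s)) has_vector_derivative d) (at t within T)"
    if "F differentiable (at (q t))" for F :: "real ^ 'n \<Rightarrow> 'b::real_normed_vector"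
  proof -
    obtain F' where "(F has_derivative F') (at (q t))"
      using \<open>F differentiable (at (q t))\<close> by (auto simp: differentiable_def)
    from vector_derivative_diff_chain_within[OF q' has_derivative_at_withinI[OF this]]
    show ?thesis by (auto simp: o_def)
  qed
  obtain A' where A': "((\<lambda>s. M (q s)) has_vector_derivative A') (at t within T)"
    using chain[OF M] by blast
  obtain a' where a': "((\<lambda>s. M (q s) *v v t) has_vector_derivative a') (at t within T)"
    using chain[OF M_app] by blast
  have v: "(v \<longlongrightarrow> v t) (at t within T)"
  proof (rule matrix_vector_mult_continuous_inverse)
    show "((\<lambda>s. M (q s)) \<longlongrightarrow> M (q t)) (at t within T)"
      using has_vector_derivative_continuous[OF A'] by (simp add: continuous_within)
    show "det (M (q t)) \<noteq> 0"
      by (rule positive_definite_imp_det_nz[OF pd])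
    show "((\<lambda>s. M (q s) *v v s) \<longlongrightarrow> M (q t) *v v t) (at t within T)"
      using has_vector_derivative_continuous[OF p'] unfolding continuous_within p_def .
  qed
  have "f differentiable (at (q t))"
    unfolding f_def lagrangian_def
    by (intro derivative_intros U differentiable_inner M_app differentiable_const)
  then have "GDERIV f (q t) :> g"
    unfolding g_def by (rule differentiable_imp_gderiv)
  then have "(f has_derivative (\<lambda>h. h \<bullet> g)) (at (q t))"
    by (simp add: gderiv_def)
  from vector_derivative_diff_chain_within[OF q' has_derivative_at_withinI[OF this]]
  have fq: "((\<lambda>s. f (q s)) has_real_derivative v t \<bullet> g) (at t within T)"
    by (simp add: o_def has_real_derivative_iff_has_vector_derivative)
  have p_inc: "((\<lambda>s. (p s - p t) \<bullet> (v s + v t)) has_real_derivative p' \<bullet> v t + p' \<bullet> v t) (at t within T)"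
    unfolding inner_add_right[symmetric]
    by (intro has_real_derivative_inner_increment p' tendsto_add v tendsto_const)
  \<comment> \<open>Both factors of the next product tend to zero and the first is differentiable at
    \<open>t\<close>, so the product contributes nothing to the derivative.\<close>
  have "((\<lambda>s. v s - v t) \<longlongrightarrow> v t - v t) (at t within T)"
    by (intro tendsto_diff v tendsto_const)
  from has_real_derivative_inner_increment[OF a' this]
  have a_inc: "((\<lambda>s. (M (q s) *v v t - M (q t) *v v t) \<bullet> (v s - v t)) has_real_derivative 0) (at t within T)"
    by simp
  define E where "E s = 1 / 2 * (v s \<bullet> (M (q s) *v v s)) + U (q s)" for s
  \<comment> \<open>In the correction term of the momentum identity, \<open>v s\<close> is split as
    \<open>v t + (v s - v t)\<close>. The part with \<open>v t\<close> combines with the increment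
    of \<open>U\<close> into minus the increment of \<open>f\<close> along \<open>q\<close>.\<close>
  have E_eq: "E = (\<lambda>s. E t + (1 / 2 * ((p s - p t) \<bullet> (v s + v t))
      - 1 / 2 * ((M (q s) *v v t - M (q t) *v v t) \<bullet> (v s - v t)) - (f (q s) - f (q t))))"
  proof
    fix s
    show "E s = E t + (1 / 2 * ((p s - p t) \<bullet> (v s + v t))
      - 1 / 2 * ((M (q s) *v v t - M (q t) *v v t) \<bullet> (v s - v t)) - (f (q s) - f (q t)))"
      unfolding E_def p_def f_def lagrangian_def
      using inner_symmetric_matrix[OF sym, of "v s" "q s" "v t"]
        inner_symmetric_matrix[OF sym, of "v t" "q t" "v s"]
      by (simp add: inner_diff_left inner_diff_right inner_add_left inner_add_right inner_commute field_simps)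
  qed
  have "((\<lambda>s. E t + (1 / 2 * ((p s - p t) \<bullet> (v s + v t))
      - 1 / 2 * ((M (q s) *v v t - M (q t) *v v t) \<bullet> (v s - v t)) - (f (q s) - f (q t))))
      has_real_derivative v t \<bullet> (p' - g)) (at t within T)"
    by (rule derivative_eq_intros p_inc a_inc fq refl)+
      (simp add: inner_diff_right inner_commute)
  then have "(E has_real_derivative v t \<bullet> (p' - g)) (at t within T)"
    by (subst E_eq)
  then show ?thesis
    unfolding E_def eq .
qed

lemma energy_terms_inner_stacked_parameters:
  fixes m_mat :: "'l::finite \<Rightarrow> real ^ 'n \<Rightarrow> real ^ 'n ^ 'n" and U_fun :: "'r::finite \<Rightarrow> real ^ 'n \<Rightarrow> real"
  shows "energy_terms m_mat U_fun x u \<bullet> stacked_parameters \<theta>M \<theta>U =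
    1 / 2 * (u \<bullet> ((\<Sum>i\<in>UNIV. (\<theta>M $ i) *\<^sub>R m_mat i x) *v u)) + (\<Sum>j\<in>UNIV. U_fun j x * \<theta>U $ j)"
proof -
  have "u \<bullet> ((\<Sum>i\<in>UNIV. (\<theta>M $ i) *\<^sub>R m_mat i x) *v u) = (\<Sum>i\<in>UNIV. \<theta>M $ i * (u \<bullet> (m_mat i x *v u)))"
    by (simp add: linear_sum[OF linear_matrix_vector_mult_left] inner_sum_right
        linear_cmul[OF linear_matrix_vector_mult_left])
  \<comment> \<open>Viewing the index type as a disjoint sum of sets lets \<open>sum.Plus\<close>
    separate the kinetic from the potential entries.\<close>
  moreover have "energy_terms m_mat U_fun x u \<bullet> stacked_parameters \<theta>M \<theta>U =
      (\<Sum>k\<in>UNIV <+> UNIV. energy_terms m_mat U_fun x u $ k * stacked_parameters \<theta>M \<theta>U $ k)"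
    by (simp add: inner_vec_def)
  ultimately show ?thesis
    unfolding sum.Plus[OF finite finite] energy_terms_def stacked_parameters_def
    by (simp add: sum_distrib_left mult_ac)
qed

text \<open>The difference of two solutions satisfies the homogeneous equation, so multiplying it by
  the integrating factor \<open>exp (lam * s)\<close> gives a constant on the interval.\<close>

lemma lti_filter_unique:
  assumes T: "is_interval T" "0 \<in> T" and "t \<in> T"
    and y: "lti_filter lam T u y" and x: "lti_filter lam T u x"
  shows "y t = x t + exp (- lam * t) * (y 0 - x 0)"
proof -
  have "((\<lambda>s. exp (lam * s) * (y s - x s)) has_field_derivative 0) (at s within T)" if "s \<in> T" for s
  proof -
    have "(y has_real_derivative - lam * y s + u s) (at s within T)"
      "(x has_real_derivative - lam * x s + u s) (at s within T)"
      using x y that by (auto simp: lti_filter_def)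
    then show ?thesis
      by (auto intro!: derivative_eq_intros simp: algebra_simps)
  qed
  from has_field_derivative_zero_constant[OF is_interval_convex[OF T(1)] this]
  obtain c where "\<forall>s\<in>T. exp (lam * s) * (y s - x s) = c" ..
  from bspec[OF this \<open>0 \<in> T\<close>] bspec[OF this \<open>t \<in> T\<close>]
  have "exp (lam * t) * (y t - x t) = y 0 - x 0"
    by simp
  then have "exp (- lam * t) * (y 0 - x 0) = (exp (- lam * t) * exp (lam * t)) * (y t - x t)"
    by (metis mult.assoc)
  then show ?thesis
    by (simp flip: exp_add)
qed

text \<open>The filter state starts anywhere, so the regression equation holds up to a transient
  that decays because \<open>lam > 0\<close>; it is exact when the initial values match.\<close>

theorem proposition2p1:
  fixes M :: "real ^ 'n \<Rightarrow> real ^ 'n ^ 'n"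
    and U :: "real ^ 'n \<Rightarrow> real"
    and G :: "real ^ 'n \<Rightarrow> real ^ 'n \<Rightarrow> real ^ 'm ^ 'n"
    and m_mat :: "'l::finite \<Rightarrow> real ^ 'n \<Rightarrow> real ^ 'n ^ 'n"
    and U_fun :: "'r::finite \<Rightarrow> real ^ 'n \<Rightarrow> real"
    and \<theta>M :: "real ^ 'l"
    and \<theta>U :: "real ^ 'r"
    and \<theta> :: "real ^ ('l + 'r)"
    and lam :: real
    and T :: "real set"
    and \<tau> :: "real \<Rightarrow> real ^ 'm"
    and q v :: "real \<Rightarrow> real ^ 'n"
    and z \<omega> \<Omega> :: "real \<Rightarrow> real ^ ('l + 'r)"
  assumes "CARD('m) \<le> CARD('n)"
    and "\<And>x. positive_definite (M x)"
    and "\<And>x. M x = (\<Sum>i\<in>UNIV. (\<theta>M $ i) *\<^sub>R m_mat i x)"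
    and "\<And>x. U x = (\<Sum>j\<in>UNIV. U_fun j x * \<theta>U $ j)"
    and "\<And>x. M differentiable (at x)"
    and "\<And>x. U differentiable (at x)"
    and "\<theta> = stacked_parameters \<theta>M \<theta>U"
    and "is_interval T" and "0 \<in> T"
    and "euler_lagrange_trajectory (lagrangian M U) G T \<tau> q v"
    and "lam > 0"
    and "\<And>t. t \<in> T \<Longrightarrow> \<omega> t = energy_terms m_mat U_fun (q t) (v t)"
    and "\<And>t. t \<in> T \<Longrightarrow>
           (z has_vector_derivative (- lam) *\<^sub>R (z t + \<omega> t)) (at t within T)"
    and "\<And>t. t \<in> T \<Longrightarrow> \<Omega> t = z t + \<omega> t"
  shows "lti_filter lam T (\<lambda>t. v t \<bullet> (G (q t) (v t) *v \<tau> t)) (\<lambda>t. \<Omega> t \<bullet> \<theta>) \<and>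
    (\<forall>y. lti_filter lam T (\<lambda>t. v t \<bullet> (G (q t) (v t) *v \<tau> t)) y \<longrightarrow>
      (\<forall>t\<in>T. y t = \<Omega> t \<bullet> \<theta> + exp (- lam * t) * (y 0 - \<Omega> 0 \<bullet> \<theta>)) \<and>
      (y 0 = \<Omega> 0 \<bullet> \<theta> \<longrightarrow> (\<forall>t\<in>T. y t = \<Omega> t \<bullet> \<theta>)))"
proof -
  let ?P = "\<lambda>t. v t \<bullet> (G (q t) (v t) *v \<tau> t)"
  have \<omega>: "\<omega> t \<bullet> \<theta> = 1 / 2 * (v t \<bullet> (M (q t) *v v t)) + U (q t)" if "t \<in> T" for t
    unfolding assms(12)[OF that] assms(7) energy_terms_inner_stacked_parameters assms(3,4) ..
  have filter: "lti_filter lam T ?P (\<lambda>t. \<Omega> t \<bullet> \<theta>)"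
    unfolding lti_filter_def
  proof
    fix t assume t: "t \<in> T"
    have z': "((\<lambda>s. z s \<bullet> \<theta>) has_real_derivative ((- lam) *\<^sub>R (z t + \<omega> t)) \<bullet> \<theta>) (at t within T)"
      using bounded_linear.has_vector_derivative[OF bounded_linear_inner_left assms(13)[OF t]]
      by (simp add: has_real_derivative_iff_has_vector_derivative)
    \<comment> \<open>Replacing \<open>\<omega> s \<bullet> \<theta>\<close> by the energy lets the
      power balance supply its derivative, while the equation for \<open>z\<close> supplies the
      damping term.\<close>
    have "((\<lambda>s. z s \<bullet> \<theta> + (1 / 2 * (v s \<bullet> (M (q s) *v v s)) + U (q s))) has_real_derivative
        - lam * (\<Omega> t \<bullet> \<theta>) + ?P t) (at t within T)"
      using DERIV_add[OF z' energy_balance[OF assms(2,5,6,10) t]] assms(14)[OF t] by simp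
    \<comment> \<open>The two functions are only known to agree on \<open>T\<close>, hence the
      transfer within \<open>T\<close>; the radius 1 is arbitrary.\<close>
    then show "((\<lambda>s. \<Omega> s \<bullet> \<theta>) has_real_derivative - lam * (\<Omega> t \<bullet> \<theta>) + ?P t) (at t within T)"
      by (rule has_field_derivative_transform_within[OF _ zero_less_one t])
        (simp add: assms(14) inner_add_left \<omega>)
  qed
  moreover have sol: "y t = \<Omega> t \<bullet> \<theta> + exp (- lam * t) * (y 0 - \<Omega> 0 \<bullet> \<theta>)"
    if "lti_filter lam T ?P y" "t \<in> T" for y t
    using lti_filter_unique[OF assms(8,9) that(2,1) filter] .
  moreover have "y t = \<Omega> t \<bullet> \<theta>"
    if "lti_filter lam T ?P y" "y 0 = \<Omega> 0 \<bullet> \<theta>" "t \<in> T" for y t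
    unfolding sol[OF that(1,3)] that(2) by simp
  ultimately show ?thesis
    by blast
qed

end
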